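(* If $C$ is a closure system in a domain $P$, then $\mathrm{dcclsys}(C)=\mathrm{dj}(C)$; therefore, if $X$ is any subset of $P$, then $\mathrm{dcclsys}(X)=\mathrm{dj}(\mathrm{clsys}(X))$.
   Context: A dcpo is a poset in which every directed (in particular nonempty) subset has a join. For $x,y\in P$, $x\ll y$ ($x$ is way below $y$) means that for every directed subset $D$ of $P$ having a join, $y\le\bigvee D$ implies $x\le d$ for some $d\in D$. A poset $P$ is continuous if for every $x\in P$ the set $\{u\in P: u\ll x\}$ is directed with join $x$. A domain is a continuous dcpo. A closure operator on $P$ is an increasing, ascending ($x\le\gamma(x)$), idempotent map $P\to P$; a closure system in $P$ is the fixpoint set of a closure operator on $P$; equivalently, a subset $C\subseteq P$ such that for every $x\in P$ the set $\{y\in C: y\ge x\}$ has a least element. A subset of a dcpo $P$ is directed-closed if it contains the join of each of its directed subsets. In a dcpo $P$, the intersection of any set of closure systems is a closure system, and likewise for directed-closed closure systems. For $X\subseteq P$: $\mathrm{clsys}(X)$ is the least closure system in $P$ that includes $X$; $\mathrm{dcclsys}(X)$ is the least directed-closed closure system in $P$ that includes $X$; $\mathrm{dj}(X)$ is the set of the joins (in $P$) of all directed subsets of $X$. *)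

theory Defs
  imports "HOL-Algebra.Complete_Lattice"
begin

definition directed_in :: "('a, 'b) gorder_scheme \<Rightarrow> 'a set \<Rightarrow> bool" where
  "directed_in P D \<longleftrightarrow> D \<subseteq> carrier P \<and> D \<noteq> {} \<and>
     (\<forall>x\<in>D. \<forall>y\<in>D. \<exists>z\<in>D. x \<sqsubseteq>\<^bsub>P\<^esub> z \<and> y \<sqsubseteq>\<^bsub>P\<^esub> z)"

definition way_below :: "('a, 'b) gorder_scheme \<Rightarrow> 'a \<Rightarrow> 'a \<Rightarrow> bool" where
  "way_below P x y \<longleftrightarrow> x \<in> carrier P \<and> y \<in> carrier P \<and>
     (\<forall>D s. directed_in P D \<and> is_lub P s D \<and> y \<sqsubseteq>\<^bsub>P\<^esub> s \<longrightarrow> (\<exists>d\<in>D. x \<sqsubseteq>\<^bsub>P\<^esub> d))"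

locale dcpo = partial_order P for P (structure) +
  assumes directed_lub_exists: "directed_in P D \<Longrightarrow> \<exists>s. is_lub P s D"

locale continuous_poset = partial_order P for P (structure) +
  assumes directed_way_below: "x \<in> carrier P \<Longrightarrow> directed_in P {u \<in> carrier P. way_below P u x}"
    and lub_way_below: "x \<in> carrier P \<Longrightarrow> is_lub P x {u \<in> carrier P. way_below P u x}"

text \<open>Domains in the order-theoretic sense; the plain name \<open>domain\<close> is the locale of integral
  domains in HOL-Algebra.\<close>

locale domain_poset = dcpo P + continuous_poset P for P (structure)

definition closure_operator :: "('a, 'b) gorder_scheme \<Rightarrow> ('a \<Rightarrow> 'a) \<Rightarrow> bool" where
  "closure_operator P \<gamma> \<longleftrightarrow> \<gamma> \<in> carrier P \<rightarrow> carrier P \<and> isotone P P \<gamma> \<and>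
     (\<forall>x\<in>carrier P. x \<sqsubseteq>\<^bsub>P\<^esub> \<gamma> x) \<and> idempotent P \<gamma>"

definition closure_system :: "('a, 'b) gorder_scheme \<Rightarrow> 'a set \<Rightarrow> bool" where
  "closure_system P C \<longleftrightarrow> (\<exists>\<gamma>. closure_operator P \<gamma> \<and> C = fps P \<gamma>)"

definition directed_closed :: "('a, 'b) gorder_scheme \<Rightarrow> 'a set \<Rightarrow> bool" where
  "directed_closed P C \<longleftrightarrow> C \<subseteq> carrier P \<and>
     (\<forall>D s. directed_in P D \<and> D \<subseteq> C \<and> is_lub P s D \<longrightarrow> s \<in> C)"

text \<open>Below, \<open>LEAST\<close> refers to inclusion of sets. The least systems exist when \<open>P\<close> is a dcpo and
  \<open>X \<subseteq> carrier P\<close>, since (directed-closed) closure systems in a dcpo are closed under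
  intersection; otherwise the value may be unspecified.\<close>

definition clsys :: "('a, 'b) gorder_scheme \<Rightarrow> 'a set \<Rightarrow> 'a set" where
  "clsys P X = (LEAST C. closure_system P C \<and> X \<subseteq> C)"

definition dcclsys :: "('a, 'b) gorder_scheme \<Rightarrow> 'a set \<Rightarrow> 'a set" where
  "dcclsys P X = (LEAST C. closure_system P C \<and> directed_closed P C \<and> X \<subseteq> C)"

definition dj :: "('a, 'b) gorder_scheme \<Rightarrow> 'a set \<Rightarrow> 'a set" where
  "dj P X = {s. \<exists>D. directed_in P D \<and> D \<subseteq> X \<and> is_lub P s D}"

end

theory Submission
  imports Defs
begin

text \<open>For a closure operator \<open>\<gamma>\<close> with fixpoint set \<open>C\<close>, the least element of \<open>dj C\<close> above \<open>x\<close> is the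
  directed join of the elements \<open>\<gamma> u\<close> with \<open>u\<close> way below \<open>x\<close>: if \<open>x\<close> lies below the join of a
  directed \<open>D \<subseteq> C\<close>, then every such \<open>u\<close>, hence also \<open>\<gamma> u\<close>, lies below some element of \<open>D\<close>.
  So \<open>dj C\<close> is a closure system, and interpolation shows that it is directed-closed.
  That \<open>clsys X\<close> is itself a closure system rests on Pataraia's argument: the increasing ascending
  maps that fix a given set pointwise are directed under composition, so their pointwise join
  absorbs each of them.\<close>

section \<open>Joins in partially ordered sets\<close>

lemma is_lub_iff:
  assumes "A \<subseteq> carrier P"
  shows "is_lub P s A \<longleftrightarrow> s \<in> carrier P \<and> (\<forall>a\<in>A. a \<sqsubseteq>\<^bsub>P\<^esub> s) \<and>
    (\<forall>b\<in>carrier P. (\<forall>a\<in>A. a \<sqsubseteq>\<^bsub>P\<^esub> b) \<longrightarrow> s \<sqsubseteq>\<^bsub>P\<^esub> b)"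
  using assms unfolding least_def Upper_def by blast

lemma directed_inD: "directed_in P D \<Longrightarrow> D \<subseteq> carrier P"
  by (simp add: directed_in_def)

lemma is_lub_closed: "is_lub P s A \<Longrightarrow> s \<in> carrier P"
  unfolding least_def Upper_def by blast

lemma is_lub_upper: "is_lub P s A \<Longrightarrow> A \<subseteq> carrier P \<Longrightarrow> a \<in> A \<Longrightarrow> a \<sqsubseteq>\<^bsub>P\<^esub> s"
  by (simp add: is_lub_iff)

lemma is_lub_le:
  assumes "is_lub P s A" "A \<subseteq> carrier P" "b \<in> carrier P" "\<And>a. a \<in> A \<Longrightarrow> a \<sqsubseteq>\<^bsub>P\<^esub> b"
  shows "s \<sqsubseteq>\<^bsub>P\<^esub> b"
  using assms by (simp add: is_lub_iff)

lemma directed_in_image: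
  assumes "directed_in P D" "f \<in> carrier P \<rightarrow> carrier P"
    and "\<And>x y. x \<in> carrier P \<Longrightarrow> y \<in> carrier P \<Longrightarrow> x \<sqsubseteq>\<^bsub>P\<^esub> y \<Longrightarrow> f x \<sqsubseteq>\<^bsub>P\<^esub> f y"
  shows "directed_in P (f ` D)"
  unfolding directed_in_def
proof (intro conjI ballI)
  show "f ` D \<subseteq> carrier P" "f ` D \<noteq> {}"
    using assms(1,2) unfolding directed_in_def by blast+
next
  fix a b assume "a \<in> f ` D" "b \<in> f ` D"
  then obtain x y where xy: "x \<in> D" "y \<in> D" "a = f x" "b = f y" by blast
  then obtain z where "z \<in> D" "x \<sqsubseteq>\<^bsub>P\<^esub> z" "y \<sqsubseteq>\<^bsub>P\<^esub> z"
    using assms(1) unfolding directed_in_def by blast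
  then show "\<exists>c\<in>f ` D. a \<sqsubseteq>\<^bsub>P\<^esub> c \<and> b \<sqsubseteq>\<^bsub>P\<^esub> c"
    using xy assms(3) directed_inD[OF assms(1)] by blast
qed

lemma way_below_closed: "way_below P x y \<Longrightarrow> x \<in> carrier P" "way_below P x y \<Longrightarrow> y \<in> carrier P"
  by (simp_all add: way_below_def)

lemma way_belowD:
  "way_below P x y \<Longrightarrow> directed_in P D \<Longrightarrow> is_lub P s D \<Longrightarrow> y \<sqsubseteq>\<^bsub>P\<^esub> s \<Longrightarrow> \<exists>d\<in>D. x \<sqsubseteq>\<^bsub>P\<^esub> d"
  unfolding way_below_def by blast

context partial_order
begin

lemma is_lub_singleton: "x \<in> carrier L \<Longrightarrow> is_lub L x {x}"
  by (simp add: is_lub_iff)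

lemma directed_in_singleton: "x \<in> carrier L \<Longrightarrow> directed_in L {x}"
  by (simp add: directed_in_def)

lemma subset_dj:
  assumes "C \<subseteq> carrier L"
  shows "C \<subseteq> dj L C"
proof
  fix x assume "x \<in> C"
  then show "x \<in> dj L C"
    using assms directed_in_singleton[of x] is_lub_singleton[of x] unfolding dj_def by blast
qed

section \<open>The way-below relation in a partial order\<close>

lemma way_below_imp_le: "way_below L x y \<Longrightarrow> x \<sqsubseteq> y"
  using way_belowD[OF _ directed_in_singleton[of y] is_lub_singleton[of y]] way_below_closed[of L x y]
  by auto

lemma le_way_below:
  assumes "x \<in> carrier L" "x \<sqsubseteq> y" "way_below L y z"
  shows "way_below L x z"
  unfolding way_below_def
proof (intro conjI allI impI)
  fix D s assume D: "directed_in L D \<and> is_lub L s D \<and> z \<sqsubseteq> s"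
  then obtain d where "d \<in> D" "y \<sqsubseteq> d" using way_belowD[OF assms(3)] by blast
  then show "\<exists>d\<in>D. x \<sqsubseteq> d"
    using D assms le_trans way_below_closed[OF assms(3)] directed_inD[of L D] by blast
qed (use assms way_below_closed in auto)

lemma way_below_le:
  assumes "way_below L x y" "y \<sqsubseteq> z" "z \<in> carrier L"
  shows "way_below L x z"
  unfolding way_below_def
proof (intro conjI allI impI)
  fix D s assume D: "directed_in L D \<and> is_lub L s D \<and> z \<sqsubseteq> s"
  then have "y \<sqsubseteq> s"
    using assms le_trans is_lub_closed[of L s D] way_below_closed[OF assms(1)] by blast
  then show "\<exists>d\<in>D. x \<sqsubseteq> d" using D way_belowD[OF assms(1)] by blast
qed (use assms way_below_closed in auto)

section \<open>Closure operators and closure systems\<close>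

lemma closure_operator_iff:
  "closure_operator L \<gamma> \<longleftrightarrow> \<gamma> \<in> carrier L \<rightarrow> carrier L \<and>
     (\<forall>x\<in>carrier L. \<forall>y\<in>carrier L. x \<sqsubseteq> y \<longrightarrow> \<gamma> x \<sqsubseteq> \<gamma> y) \<and>
     (\<forall>x\<in>carrier L. x \<sqsubseteq> \<gamma> x) \<and> (\<forall>x\<in>carrier L. \<gamma> (\<gamma> x) = \<gamma> x)"
  \<comment> \<open>\<open>isotone\<close> also asserts that source and target are weak partial
    orders, and \<open>idempotent\<close> is stated with \<open>.=\<close>, which is equality
    here.\<close>
  unfolding closure_operator_def isotone_def idempotent_def eq_is_equal
  using weak_partial_order_axioms by auto

lemma closure_systemE:
  assumes "closure_system L C"
  obtains \<gamma> where "\<gamma> \<in> carrier L \<rightarrow> carrier L" "C \<subseteq> carrier L"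
    "\<And>x y. x \<in> carrier L \<Longrightarrow> y \<in> carrier L \<Longrightarrow> x \<sqsubseteq> y \<Longrightarrow> \<gamma> x \<sqsubseteq> \<gamma> y"
    "\<And>x. x \<in> carrier L \<Longrightarrow> x \<sqsubseteq> \<gamma> x" "\<And>x. x \<in> carrier L \<Longrightarrow> \<gamma> x \<in> C"
    "\<And>x. x \<in> C \<Longrightarrow> \<gamma> x = x"
proof -
  from assms obtain \<gamma> where "closure_operator L \<gamma>" "C = fps L \<gamma>"
    unfolding closure_system_def by blast
  then show thesis
    unfolding closure_operator_iff fps_def eq_is_equal by (intro that[of \<gamma>]) auto
qed

text \<open>Choosing the least element of \<open>C\<close> above each point gives the closure
  operator: comparing least elements yields monotonicity, and a point of \<open>C\<close> is least
  above itself, so \<open>C\<close> is exactly the fixpoint set.\<close>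

lemma closure_systemI:
  assumes "C \<subseteq> carrier L"
    and "\<And>x. x \<in> carrier L \<Longrightarrow> \<exists>c\<in>C. x \<sqsubseteq> c \<and> (\<forall>y\<in>C. x \<sqsubseteq> y \<longrightarrow> c \<sqsubseteq> y)"
  shows "closure_system L C"
proof -
  obtain \<gamma> where "\<forall>x\<in>carrier L. \<gamma> x \<in> C \<and> x \<sqsubseteq> \<gamma> x \<and> (\<forall>y\<in>C. x \<sqsubseteq> y \<longrightarrow> \<gamma> x \<sqsubseteq> y)"
    using assms(2) by metis
  then have \<gamma>: "\<gamma> x \<in> C" "x \<sqsubseteq> \<gamma> x" "\<And>y. y \<in> C \<Longrightarrow> x \<sqsubseteq> y \<Longrightarrow> \<gamma> x \<sqsubseteq> y"
    if "x \<in> carrier L" for x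
    using that by blast+
  have fix_eq: "\<gamma> x = x" if "x \<in> C" for x
    using \<gamma>[of x] that assms(1) le_refl le_antisym by (meson subsetD)
  have mono: "\<gamma> x \<sqsubseteq> \<gamma> y" if "x \<in> carrier L" "y \<in> carrier L" "x \<sqsubseteq> y" for x y
    using \<gamma>(1,2)[of y] \<gamma>(3)[of x "\<gamma> y"] that assms(1) le_trans by blast
  have "closure_operator L \<gamma>"
    unfolding closure_operator_iff using \<gamma>(1,2) fix_eq mono assms(1) by blast
  moreover have "C = fps L \<gamma>"
    unfolding fps_def eq_is_equal using \<gamma>(1) fix_eq assms(1) by force
  ultimately show ?thesis unfolding closure_system_def by blast
qed

lemma closure_system_subset: "closure_system L C \<Longrightarrow> C \<subseteq> carrier L"
  by (elim closure_systemE)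

end

section \<open>Intersections of closure systems\<close>

text \<open>A dcpo may lack infima, so the least point of \<open>?F\<close> above \<open>x\<close>
  is not sought as an infimum; it is \<open>T x\<close> for the greatest map \<open>T\<close> in the
  monoid \<open>M\<close>. The factor \<open>carrier P\<close> settles the case of an empty
  family.\<close>

lemma (in dcpo) closure_system_Inter:
  assumes cs: "\<And>C. C \<in> \<C> \<Longrightarrow> closure_system P C"
  shows "closure_system P (carrier P \<inter> \<Inter>\<C>)" (is "closure_system P ?F")
proof -
  \<comment> \<open>Idempotence is left out on purpose: it would not survive composition. The
    closure operators of all members of \<open>\<C>\<close> lie in \<open>M\<close>.\<close>
  define M where "M = {f \<in> carrier P \<rightarrow> carrier P.
    (\<forall>x\<in>carrier P. \<forall>y\<in>carrier P. x \<sqsubseteq> y \<longrightarrow> f x \<sqsubseteq> f y) \<and>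
    (\<forall>x\<in>carrier P. x \<sqsubseteq> f x) \<and> (\<forall>x\<in>?F. f x = x)}"
  have M_closed: "f x \<in> carrier P" if "f \<in> M" "x \<in> carrier P" for f x
    using that unfolding M_def by blast
  have M_mono: "f x \<sqsubseteq> f y" if "f \<in> M" "x \<in> carrier P" "y \<in> carrier P" "x \<sqsubseteq> y" for f x y
    using that unfolding M_def by blast
  have M_asc: "x \<sqsubseteq> f x" if "f \<in> M" "x \<in> carrier P" for f x
    using that unfolding M_def by blast
  have M_fix: "f x = x" if "f \<in> M" "x \<in> ?F" for f x
    using that unfolding M_def by blast
  have M_id: "(\<lambda>x. x) \<in> M" unfolding M_def by auto
  have M_comp: "(\<lambda>x. f (g x)) \<in> M" if f: "f \<in> M" and g: "g \<in> M" for f g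
  proof -
    have "x \<sqsubseteq> f (g x)" if x: "x \<in> carrier P" for x
      using le_trans[OF M_asc[OF g x] M_asc[OF f M_closed[OF g x]]] x
        M_closed[OF g x] M_closed[OF f M_closed[OF g x]] by blast
    moreover have "f (g x) \<sqsubseteq> f (g y)" if "x \<in> carrier P" "y \<in> carrier P" "x \<sqsubseteq> y" for x y
      by (intro M_mono[OF f] M_mono[OF g] M_closed[OF g] that)
    moreover have "f (g x) = x" if "x \<in> ?F" for x
      using M_fix[OF f that] M_fix[OF g that] by simp
    moreover have "(\<lambda>x. f (g x)) \<in> carrier P \<rightarrow> carrier P"
      using M_closed[OF f] M_closed[OF g] by blast
    ultimately show ?thesis unfolding M_def by blast
  qed
  have orbit_carrier: "(\<lambda>f. f x) ` M \<subseteq> carrier P" if "x \<in> carrier P" for x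
    using M_closed that by blast
  have "directed_in P ((\<lambda>f. f x) ` M)" if x: "x \<in> carrier P" for x
  proof -
    \<comment> \<open>The composite of \<open>f\<close> after \<open>g\<close> bounds both:
      \<open>g\<close> ascends and \<open>f\<close> is monotone, and \<open>f\<close> itself
      ascends.\<close>
    have "\<exists>h\<in>M. f x \<sqsubseteq> h x \<and> g x \<sqsubseteq> h x" if f: "f \<in> M" and g: "g \<in> M" for f g
    proof (rule bexI[OF _ M_comp[OF f g]], rule conjI)
      show "f x \<sqsubseteq> f (g x)" by (rule M_mono[OF f x M_closed[OF g x] M_asc[OF g x]])
      show "g x \<sqsubseteq> f (g x)" by (rule M_asc[OF f M_closed[OF g x]])
    qed
    then show ?thesis
      using orbit_carrier[OF x] M_id unfolding directed_in_def by blast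
  qed
  then have "\<forall>x\<in>carrier P. \<exists>s. is_lub P s ((\<lambda>f. f x) ` M)"
    using directed_lub_exists by blast
  then obtain T where "\<forall>x\<in>carrier P. is_lub P (T x) ((\<lambda>f. f x) ` M)"
    by (rule bchoice[THEN exE])
  then have T: "is_lub P (T x) ((\<lambda>f. f x) ` M)" if "x \<in> carrier P" for x
    using that by blast
  have T_closed: "T x \<in> carrier P" if "x \<in> carrier P" for x
    using T[OF that] by (rule is_lub_closed)
  have T_upper: "f x \<sqsubseteq> T x" if "x \<in> carrier P" "f \<in> M" for f x
    by (rule is_lub_upper[OF T orbit_carrier imageI]) (fact that)+
  have T_le: "T x \<sqsubseteq> b" if "x \<in> carrier P" "b \<in> carrier P" "\<And>f. f \<in> M \<Longrightarrow> f x \<sqsubseteq> b" for x b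
    using is_lub_le[OF T[OF that(1)] orbit_carrier[OF that(1)] that(2)] that(3) by blast
  have T_mono: "T x \<sqsubseteq> T y" if "x \<in> carrier P" "y \<in> carrier P" "x \<sqsubseteq> y" for x y
  proof (rule T_le)
    fix f assume f: "f \<in> M"
    show "f x \<sqsubseteq> T y"
      by (rule le_trans[OF M_mono[OF f that] T_upper[OF that(2) f]])
        (intro M_closed[OF f] T_closed that)+
  qed (intro T_closed that)+
  have T_fix: "T x = x" if "x \<in> ?F" for x
  proof (rule le_antisym)
    have x: "x \<in> carrier P" using that by blast
    show "T x \<sqsubseteq> x" by (rule T_le[OF x x]) (simp add: M_fix[OF _ that] x)
    show "x \<sqsubseteq> T x" by (rule T_upper[OF x M_id])
    show "T x \<in> carrier P" "x \<in> carrier P" using T_closed[OF x] x by auto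
  qed
  \<comment> \<open>Membership makes \<open>T\<close> the greatest element of \<open>M\<close>, so
    composites with \<open>T\<close> stay below \<open>T\<close>.\<close>
  have T_M: "T \<in> M"
    unfolding M_def using T_closed T_mono T_fix T_upper[OF _ M_id] by simp
  have T_F: "T x \<in> ?F" if x: "x \<in> carrier P" for x
  proof -
    have "T x \<in> C" if C: "C \<in> \<C>" for C
    proof -
      obtain \<gamma> where \<gamma>: "\<gamma> \<in> carrier P \<rightarrow> carrier P"
        "\<And>x y. x \<in> carrier P \<Longrightarrow> y \<in> carrier P \<Longrightarrow> x \<sqsubseteq> y \<Longrightarrow> \<gamma> x \<sqsubseteq> \<gamma> y"
        "\<And>x. x \<in> carrier P \<Longrightarrow> x \<sqsubseteq> \<gamma> x" "\<And>x. x \<in> carrier P \<Longrightarrow> \<gamma> x \<in> C"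
        "\<And>x. x \<in> C \<Longrightarrow> \<gamma> x = x"
        by (rule closure_systemE[OF cs[OF C]], rule that; assumption)
      have "\<gamma> \<in> M"
        unfolding M_def mem_Collect_eq
      proof (intro conjI ballI impI)
        show "\<gamma> y = y" if "y \<in> ?F" for y using \<gamma>(5)[of y] that C by blast
      qed (fact \<gamma>(1), fact \<gamma>(2), fact \<gamma>(3))
      \<comment> \<open>The composite of \<open>\<gamma>\<close> after \<open>T\<close> is in
        \<open>M\<close>, hence below \<open>T\<close>; as \<open>\<gamma>\<close> ascends,
        \<open>T x\<close> is a fixpoint of \<open>\<gamma>\<close>.\<close>
      then have "\<gamma> (T x) \<sqsubseteq> T x" by (rule T_upper[OF x M_comp[OF _ T_M]])
      then have "\<gamma> (T x) = T x"
        using le_antisym[OF _ \<gamma>(3)[OF T_closed[OF x]]] \<gamma>(1) T_closed[OF x] by blast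
      then show ?thesis using \<gamma>(4) T_closed[OF x] by metis
    qed
    then show ?thesis using T_closed[OF x] by blast
  qed
  show ?thesis
  proof (rule closure_systemI)
    fix x assume x: "x \<in> carrier P"
    \<comment> \<open>\<open>T\<close> fixes \<open>y\<close>, so monotonicity alone gives
      leastness.\<close>
    have "T x \<sqsubseteq> y" if "y \<in> ?F" "x \<sqsubseteq> y" for y
      using T_mono[OF x _ that(2)] T_fix[OF that(1)] that(1) by auto
    then show "\<exists>c\<in>?F. x \<sqsubseteq> c \<and> (\<forall>y\<in>?F. x \<sqsubseteq> y \<longrightarrow> c \<sqsubseteq> y)"
      using T_F[OF x] T_upper[OF x M_id] by blast
  qed blast
qed

text \<open>The intersection of all closure systems that include \<open>X\<close> is one of them, so
  the \<open>LEAST\<close> in the definition of \<open>clsys\<close> is attained.\<close>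

lemma (in dcpo) clsys_least:
  assumes "X \<subseteq> carrier P"
  shows "closure_system P (clsys P X)" "X \<subseteq> clsys P X"
    "\<And>C. closure_system P C \<Longrightarrow> X \<subseteq> C \<Longrightarrow> clsys P X \<subseteq> C"
proof -
  define I where "I = carrier P \<inter> \<Inter>{C. closure_system P C \<and> X \<subseteq> C}"
  have I: "closure_system P I" "X \<subseteq> I"
    using closure_system_Inter[of "{C. closure_system P C \<and> X \<subseteq> C}"] assms
    unfolding I_def by blast+
  have least: "I \<subseteq> C" if "closure_system P C" "X \<subseteq> C" for C
    using that unfolding I_def by blast
  have "clsys P X = I"
    unfolding clsys_def using I least by (intro Least_equality) auto
  then show "closure_system P (clsys P X)" "X \<subseteq> clsys P X"
    "\<And>C. closure_system P C \<Longrightarrow> X \<subseteq> C \<Longrightarrow> clsys P X \<subseteq> C"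
    using I least by auto
qed

section \<open>Directed joins of a closure system\<close>

text \<open>The elements reaching \<open>x\<close> in two way-below steps form a directed set with
  join \<open>x\<close>; testing \<open>way_below P u x\<close> against this set puts
  \<open>u\<close> below one of them.\<close>

lemma (in continuous_poset) way_below_interpolation:
  assumes ux: "way_below P u x"
  shows "\<exists>v. way_below P u v \<and> way_below P v x"
proof -
  define B where "B y = {w \<in> carrier P. way_below P w y}" for y
  define W where "W = (\<Union>v\<in>B x. B v)"
  have x: "x \<in> carrier P" using way_below_closed[OF ux] by blast
  have B_carrier: "B y \<subseteq> carrier P" for y unfolding B_def by blast
  have B_dir: "directed_in P (B y)" if "y \<in> carrier P" for y
    unfolding B_def by (rule directed_way_below[OF that])
  have B_lub: "is_lub P y (B y)" if "y \<in> carrier P" for y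
    unfolding B_def by (rule lub_way_below[OF that])
  have W_carrier: "W \<subseteq> carrier P" unfolding W_def using B_carrier by blast
  have "directed_in P W"
    unfolding directed_in_def
  proof (intro conjI ballI)
    obtain v where "v \<in> B x" using B_dir[OF x] unfolding directed_in_def by blast
    moreover then obtain w where "w \<in> B v"
      using B_dir B_carrier unfolding directed_in_def by blast
    ultimately show "W \<noteq> {}" unfolding W_def by blast
  next
    fix a b assume "a \<in> W" "b \<in> W"
    then obtain p q where pq: "p \<in> B x" "q \<in> B x" "a \<in> B p" "b \<in> B q" unfolding W_def by blast
    then obtain v where v: "v \<in> B x" "p \<sqsubseteq> v" "q \<sqsubseteq> v"
      using B_dir[OF x] unfolding directed_in_def by blast
    \<comment> \<open>Passing to \<open>v\<close> brings \<open>a\<close> and \<open>b\<close> into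
      the same directed set \<open>B v\<close>.\<close>
    have "a \<in> B v" "b \<in> B v"
      using pq v way_below_le[of a p v] way_below_le[of b q v] unfolding B_def by auto
    then obtain w where "w \<in> B v" "a \<sqsubseteq> w" "b \<sqsubseteq> w"
      using B_dir[of v] v(1) B_carrier unfolding directed_in_def by blast
    then show "\<exists>w\<in>W. a \<sqsubseteq> w \<and> b \<sqsubseteq> w" using v(1) unfolding W_def by blast
  qed (rule W_carrier)
  moreover have "is_lub P x W"
    unfolding is_lub_iff[OF W_carrier]
  proof (intro conjI ballI impI)
    fix w assume "w \<in> W"
    then obtain v where "way_below P v x" "way_below P w v" unfolding W_def B_def by blast
    then show "w \<sqsubseteq> x"
      by (metis le_trans way_below_imp_le way_below_closed)
  next
    fix b assume b: "b \<in> carrier P" "\<forall>w\<in>W. w \<sqsubseteq> b"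
    \<comment> \<open>Each \<open>v\<close> is the join of \<open>B v\<close>, a subset of
      \<open>W\<close>, so an upper bound of \<open>W\<close> also bounds \<open>B x\<close>, whose
      join is \<open>x\<close>.\<close>
    have "v \<sqsubseteq> b" if v: "v \<in> B x" for v
    proof (rule is_lub_le[OF B_lub B_carrier b(1)])
      show "v \<in> carrier P" using v B_carrier by blast
      show "w \<sqsubseteq> b" if "w \<in> B v" for w using b(2) that v unfolding W_def by blast
    qed
    then show "x \<sqsubseteq> b" by (rule is_lub_le[OF B_lub[OF x] B_carrier b(1)])
  qed (rule x)
  ultimately obtain w where "w \<in> W" "u \<sqsubseteq> w"
    using way_belowD[OF ux] le_refl[OF x] by blast
  then show ?thesis
    using le_way_below way_below_closed[OF ux] unfolding W_def B_def by blast
qed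

context domain_poset
begin

text \<open>The last clause admits every \<open>b\<close> in the carrier, not just members of
  \<open>dj P C\<close>. It thus serves twice: for \<open>b\<close> in \<open>dj P C\<close> it
  gives leastness of \<open>s\<close>, and for \<open>b = x\<close> it forces \<open>s = x\<close>
  when \<open>x\<close> is a directed join of members of \<open>dj P C\<close>.\<close>

lemma dj_least_aboveE:
  assumes C: "closure_system P C" and x: "x \<in> carrier P"
  obtains s where "s \<in> dj P C" "x \<sqsubseteq> s"
    "\<And>b. b \<in> carrier P \<Longrightarrow> (\<And>u. way_below P u x \<Longrightarrow> \<exists>c\<in>C. u \<sqsubseteq> c \<and> c \<sqsubseteq> b) \<Longrightarrow> s \<sqsubseteq> b"
proof -
  obtain \<gamma> where \<gamma>: "\<gamma> \<in> carrier P \<rightarrow> carrier P" and C_carrier: "C \<subseteq> carrier P"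
    and mono: "\<And>x y. x \<in> carrier P \<Longrightarrow> y \<in> carrier P \<Longrightarrow> x \<sqsubseteq> y \<Longrightarrow> \<gamma> x \<sqsubseteq> \<gamma> y"
    and asc: "\<And>x. x \<in> carrier P \<Longrightarrow> x \<sqsubseteq> \<gamma> x" and \<gamma>_C: "\<And>x. x \<in> carrier P \<Longrightarrow> \<gamma> x \<in> C"
    and fixed: "\<And>x. x \<in> C \<Longrightarrow> \<gamma> x = x"
    by (rule closure_systemE[OF C], rule that; assumption)
  define B where "B = {u \<in> carrier P. way_below P u x}"
  have B: "directed_in P B" "is_lub P x B"
    unfolding B_def using x by (rule directed_way_below, rule lub_way_below)
  have dir: "directed_in P (\<gamma> ` B)"
    by (rule directed_in_image[OF B(1) \<gamma> mono])
  then obtain s where s: "is_lub P s (\<gamma> ` B)" using directed_lub_exists by blast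
  show thesis
  proof (rule that)
    show "s \<in> dj P C" unfolding dj_def using dir s \<gamma>_C directed_inD[OF B(1)] by blast
    show "x \<sqsubseteq> s"
    proof (rule is_lub_le[OF B(2) directed_inD[OF B(1)] is_lub_closed[OF s]])
      fix u assume u: "u \<in> B"
      then have "u \<in> carrier P" unfolding B_def by blast
      moreover have "\<gamma> u \<sqsubseteq> s" using is_lub_upper[OF s directed_inD[OF dir]] u by blast
      ultimately show "u \<sqsubseteq> s"
        using le_trans[OF asc, of u s] \<gamma> is_lub_closed[OF s] by auto
    qed
  next
    fix b assume b: "b \<in> carrier P" "\<And>u. way_below P u x \<Longrightarrow> \<exists>c\<in>C. u \<sqsubseteq> c \<and> c \<sqsubseteq> b"
    show "s \<sqsubseteq> b"
    proof (rule is_lub_le[OF s directed_inD[OF dir] b(1)])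
      fix a assume "a \<in> \<gamma> ` B"
      then obtain u where u: "u \<in> carrier P" "way_below P u x" "a = \<gamma> u" unfolding B_def by blast
      then obtain c where c: "c \<in> C" "u \<sqsubseteq> c" "c \<sqsubseteq> b" using b(2) by blast
      \<comment> \<open>Since \<open>c\<close> is a fixpoint, applying \<open>\<gamma>\<close> to
        \<open>u\<close> and \<open>c\<close> keeps the upper bound \<open>c\<close>.\<close>
      then have "\<gamma> u \<sqsubseteq> c" using mono[of u c] fixed u(1) C_carrier by auto
      then show "a \<sqsubseteq> b" 
        using le_trans[of "\<gamma> u" c b] u c b(1) \<gamma>_C[of u] C_carrier by blast
    qed
  qed
qed

text \<open>A directed subset of \<open>C\<close> with join \<open>y\<close> contains the required
  \<open>c\<close>. This is the condition under which \<open>dj_least_aboveE\<close> bounds its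
  \<open>s\<close> by \<open>y\<close>.\<close>

lemma dj_way_below:
  assumes "C \<subseteq> carrier P" "y \<in> dj P C" "x \<sqsubseteq> y" "way_below P u x"
  shows "\<exists>c\<in>C. u \<sqsubseteq> c \<and> c \<sqsubseteq> y"
proof -
  from assms(2) obtain D where D: "directed_in P D" "D \<subseteq> C" "is_lub P y D"
    unfolding dj_def by blast
  then show ?thesis
    using way_belowD[OF assms(4) D(1,3) assms(3)] is_lub_upper[OF D(3) directed_inD[OF D(1)]]
    by blast
qed

lemma dj_carrier: "dj P C \<subseteq> carrier P"
  unfolding dj_def by (auto intro: is_lub_closed)

lemma closure_system_dj:
  assumes C: "closure_system P C"
  shows "closure_system P (dj P C)"
proof (rule closure_systemI[OF dj_carrier])
  fix x assume x: "x \<in> carrier P"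
  obtain s where s: "s \<in> dj P C" "x \<sqsubseteq> s" and
    le: "\<And>b. b \<in> carrier P \<Longrightarrow> (\<And>u. way_below P u x \<Longrightarrow> \<exists>c\<in>C. u \<sqsubseteq> c \<and> c \<sqsubseteq> b) \<Longrightarrow> s \<sqsubseteq> b"
    using dj_least_aboveE[OF C x] by blast
  have "s \<sqsubseteq> y" if "y \<in> dj P C" "x \<sqsubseteq> y" for y
    using le[of y] dj_way_below[OF closure_system_subset[OF C] that] dj_carrier that(1) by blast
  then show "\<exists>c\<in>dj P C. x \<sqsubseteq> c \<and> (\<forall>y\<in>dj P C. x \<sqsubseteq> y \<longrightarrow> c \<sqsubseteq> y)"
    using s by blast
qed

text \<open>It suffices that the element \<open>s\<close> of \<open>dj P C\<close> attached to
  \<open>x\<close> lies below \<open>x\<close>. Each \<open>u\<close> way below \<open>x\<close>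
  must then be separated from \<open>x\<close> by a member of \<open>C\<close>, although
  \<open>D\<close> consists only of joins of such members.\<close>

lemma directed_closed_dj:
  assumes C: "closure_system P C"
  shows "directed_closed P (dj P C)"
  unfolding directed_closed_def
proof (intro conjI allI impI)
  fix D x assume D: "directed_in P D \<and> D \<subseteq> dj P C \<and> is_lub P x D"
  then have x: "x \<in> carrier P" using is_lub_closed by blast
  note C_carrier = closure_system_subset[OF C]
  obtain s where s: "s \<in> dj P C" "x \<sqsubseteq> s" and
    le: "\<And>b. b \<in> carrier P \<Longrightarrow> (\<And>u. way_below P u x \<Longrightarrow> \<exists>c\<in>C. u \<sqsubseteq> c \<and> c \<sqsubseteq> b) \<Longrightarrow> s \<sqsubseteq> b"
    using dj_least_aboveE[OF C x] by blast
  have "s \<sqsubseteq> x"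
  proof (rule le[OF x])
    fix u assume "way_below P u x"
    \<comment> \<open>Two way-below steps are spent: \<open>v\<close> against \<open>x\<close> finds
      \<open>d\<close> in \<open>D\<close>, and \<open>u\<close> against \<open>v\<close> finds
      \<open>c\<close> in \<open>C\<close> below \<open>d\<close>.\<close>
    then obtain v where v: "way_below P u v" "way_below P v x"
      using way_below_interpolation by blast
    then obtain d where d: "d \<in> D" "v \<sqsubseteq> d"
      using way_belowD[OF v(2)] D le_refl[OF x] by blast
    then obtain c where c: "c \<in> C" "u \<sqsubseteq> c" "c \<sqsubseteq> d"
      using dj_way_below[OF C_carrier _ d(2) v(1)] D by blast
    moreover have "d \<sqsubseteq> x" using D d(1) is_lub_upper[of P x D d] directed_inD[of P D] by blast
    moreover have "d \<in> carrier P" using D d(1) directed_inD by blast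
    ultimately show "\<exists>c\<in>C. u \<sqsubseteq> c \<and> c \<sqsubseteq> x"
      using C_carrier x le_trans[of c d x] by blast
  qed
  then have "s = x" using s x dj_carrier le_antisym[of s x] by blast
  then show "x \<in> dj P C" using s(1) by simp
qed (rule dj_carrier)

section \<open>The least directed-closed closure system\<close>

lemma dcclsys_eq_dj:
  assumes "closure_system P C"
  shows "dcclsys P C = dj P C"
  unfolding dcclsys_def
proof (rule Least_equality)
  show "closure_system P (dj P C) \<and> directed_closed P (dj P C) \<and> C \<subseteq> dj P C"
    using closure_system_dj directed_closed_dj subset_dj closure_system_subset assms by blast
next
  fix E assume "closure_system P E \<and> directed_closed P E \<and> C \<subseteq> E"
  \<comment> \<open>Being directed-closed, \<open>E\<close> contains the join of every directed
    subset of \<open>C\<close>.\<close>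
  then show "dj P C \<subseteq> E" unfolding directed_closed_def dj_def by blast
qed

text \<open>A closure system includes \<open>X\<close> exactly when it includes
  \<open>clsys P X\<close>, so both \<open>LEAST\<close> terms range over the same sets.\<close>

lemma dcclsys_clsys:
  assumes "X \<subseteq> carrier P"
  shows "dcclsys P (clsys P X) = dcclsys P X"
proof -
  have "(closure_system P C \<and> directed_closed P C \<and> clsys P X \<subseteq> C) \<longleftrightarrow>
    (closure_system P C \<and> directed_closed P C \<and> X \<subseteq> C)" for C
    using clsys_least[OF assms] by blast
  then show ?thesis unfolding dcclsys_def by simp
qed

end

theorem proposition4p15:
  fixes P :: "('a, 'b) gorder_scheme"
  assumes "domain_poset P"
  shows "(\<forall>C. closure_system P C \<longrightarrow> dcclsys P C = dj P C) \<and>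
         (\<forall>X. X \<subseteq> carrier P \<longrightarrow> dcclsys P X = dj P (clsys P X))"
proof -
  interpret domain_poset P by (rule assms)
  show ?thesis using dcclsys_eq_dj dcclsys_clsys clsys_least(1) by metis
qed

end
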